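(* For each $n$, let $G_0\sim\mathrm{SBM}(K_n,\Lambda_n=[\Lambda_{i,j;n}],\tau_n)$ on $n$ vertices with communities $B_1,\dots,B_{K_n}$ of sizes $n_1,\dots,n_{K_n}$, labelled (without loss of generality) so that $n_1=\min_i n_i$. Assume there exist constants $b_1,b_2,b_3,b_4>0$ and $0<a_1<a_2<1$ such that $$n_1=b_1n^{a_1};\qquad n^*:=\max_i n_i=b_2 n;\qquad \Lambda_{1,j;n}\le b_3\frac{n^{a_2}}{n_jn_1}\ \text{ for all } j\ne1;\qquad K_n=b_4;$$ $$\Lambda_{i,j;n}\ge 5\frac{\log n}{n_in_j}\ \text{ for all } i\ne j;\qquad \Lambda_{i,i;n}\ge 5\frac{\log n}{\binom{n_i}{2}}\ \text{ for all } i.$$ Let $(W_t)$ be the block edgelighter walk started from $G_0$ with these communities and with $1-q_{i;1}=q_{i;2}=q$ for all $i$, where $q\in(0,1)$ is fixed, and let $t^\bullet_m$ be its total variation mixing time. Then $t^\bullet_m=\Omega(n^2)$ as $n\to\infty$.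
   Context: $\mathrm{SBM}(K,\Lambda,\tau)$: given $\tau:[n]\to[K]$ and a symmetric $\Lambda\in[0,1]^{K\times K}$, the random graph on $[n]$ in which each pair $\{u,v\}$ is an edge independently with probability $\Lambda_{\tau(u),\tau(v)}$; communities are $B_k=\tau^{-1}(k)$, $n_k=|B_k|$. The number of communities $K_n=b_4$ is a constant integer, at least 2. Block edgelighter walk: a time-homogeneous Markov chain $W_t$ on (community label) $\times$ (vertex) $\times\{0,1\}^{\binom V2}$, recording the walker's community, the walker's vertex, and the current graph $G_t$. If the walker is at vertex $u\in B_i$ at time $t$, then with probability $1/2$ each it stays in or leaves $B_i$. (i) If it stays, it selects $v\in B_i$ uniformly at random ($v=u$ allowed) and moves to $v$. If $v=u$ the graph is unchanged. If $v\neq u$, only the pair $\{u,v\}$ may change: if it is an edge it is removed with probability $q_{i;1}$ (otherwise kept), and if it is a non-edge it is added with probability $q_{i;2}$ (otherwise left absent), independently of the walk and of the graph history. (ii) If it leaves, it chooses a community $B_j\ne B_i$ uniformly at random among the other $K_n-1$ communities. It then independently selects a uniformly random edge $e_1$ and a uniformly random non-edge $e_2$ of the current graph between $B_i$ and $B_j$, turns $e_1$ into a non-edge and $e_2$ into an edge, and moves to a uniformly random vertex $w\in B_j$. (Convention: if there is no edge or no non-edge between $B_i$ and $B_j$, the graph is unchanged in this step.) All random choices are independent. The number $m_{ij}$ of edges between two distinct communities $B_i,B_j$ is preserved by the walk. The chain is considered on the state space restricted to states (community, vertex in that community, graph) whose graph has, between each pair of distinct communities, the same number of edges $m_{ij}$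 as $G_0$; on this space it is ergodic and reversible. The mixing time is that of this restricted chain (given $G_0$): with transition function $P$, state space $S$ and stationary distribution $\pi$, $t^\bullet_m=\min\{t\ge0:\max_{x\in S}\|P^t(x,\cdot)-\pi\|_{TV}<1/4\}$. $f=\Omega(g)$ means there are $C>0$, $n_0$ with $f(n)\ge Cg(n)$ for all $n\ge n_0$. *)

theory Defs
  imports
    "HOL-Probability.Probability"
    "HOL-Probability.Product_PMF"
    "HOL-Library.Landau_Symbols"
begin

type_synonym graph = "nat set set"

definition all_pairs :: "nat \<Rightarrow> nat set set" where
  "all_pairs n = {{u, v} | u v. u \<in> {1..n} \<and> v \<in> {1..n} \<and> u \<noteq> v}"

definition block :: "nat \<Rightarrow> (nat \<Rightarrow> nat) \<Rightarrow> nat \<Rightarrow> nat set" where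
  "block n \<tau> k = {v \<in> {1..n}. \<tau> v = k}"

abbreviation bsize :: "nat \<Rightarrow> (nat \<Rightarrow> nat) \<Rightarrow> nat \<Rightarrow> nat" where
  "bsize n \<tau> k \<equiv> card (block n \<tau> k)"

definition cross_pairs :: "nat \<Rightarrow> (nat \<Rightarrow> nat) \<Rightarrow> nat \<Rightarrow> nat \<Rightarrow> nat set set" where
  "cross_pairs n \<tau> i j = {{u, v} | u v. u \<in> block n \<tau> i \<and> v \<in> block n \<tau> j}"

text \<open>The endpoints of a pair are recovered as its minimum and maximum; their order is irrelevant
  because \<open>\<Lambda>\<close> is only used when it is symmetric.\<close>

definition SBM :: "nat \<Rightarrow> (nat \<Rightarrow> nat \<Rightarrow> real) \<Rightarrow> (nat \<Rightarrow> nat) \<Rightarrow> graph pmf" where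
  "SBM n \<Lambda> \<tau> =
     map_pmf (\<lambda>f. {e \<in> all_pairs n. f e})
       (Pi_pmf (all_pairs n) False (\<lambda>e. bernoulli_pmf (\<Lambda> (\<tau> (Min e)) (\<tau> (Max e)))))"

text \<open>States are triples (community, vertex, current graph).\<close>

type_synonym state = "nat \<times> nat \<times> graph"

text \<open>In \<open>stay_step\<close>, \<open>q1 i\<close> is the probability of removing an edge inside community \<open>i\<close>
  and \<open>q2 i\<close> that of adding a non-edge.\<close>

fun stay_step :: "nat \<Rightarrow> (nat \<Rightarrow> nat) \<Rightarrow> (nat \<Rightarrow> real) \<Rightarrow> (nat \<Rightarrow> real) \<Rightarrow> state \<Rightarrow> state pmf" where
  "stay_step n \<tau> q1 q2 (i, u, G) = do {
     v \<leftarrow> pmf_of_set (block n \<tau> i);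
     if v = u then return_pmf (i, u, G)
     else if {u, v} \<in> G then do {
       remove \<leftarrow> bernoulli_pmf (q1 i);
       return_pmf (i, v, if remove then G - {{u, v}} else G)
     } else do {
       add \<leftarrow> bernoulli_pmf (q2 i);
       return_pmf (i, v, if add then insert {u, v} G else G)
     }
   }"

fun leave_step :: "nat \<Rightarrow> nat \<Rightarrow> (nat \<Rightarrow> nat) \<Rightarrow> state \<Rightarrow> state pmf" where
  "leave_step n K \<tau> (i, u, G) = do {
     j \<leftarrow> pmf_of_set ({1..K} - {i});
     w \<leftarrow> pmf_of_set (block n \<tau> j);
     let E = cross_pairs n \<tau> i j \<inter> G;
     let N = cross_pairs n \<tau> i j - G;
     if E = {} \<or> N = {} then return_pmf (j, w, G)
     else do {
       e1 \<leftarrow> pmf_of_set E;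
       e2 \<leftarrow> pmf_of_set N;
       return_pmf (j, w, insert e2 (G - {e1}))
     }
   }"

definition walk_step ::
    "nat \<Rightarrow> nat \<Rightarrow> (nat \<Rightarrow> nat) \<Rightarrow> (nat \<Rightarrow> real) \<Rightarrow> (nat \<Rightarrow> real) \<Rightarrow> state \<Rightarrow> state pmf" where
  "walk_step n K \<tau> q1 q2 x = do {
     stay \<leftarrow> bernoulli_pmf (1/2);
     if stay then stay_step n \<tau> q1 q2 x else leave_step n K \<tau> x
   }"

definition state_space :: "nat \<Rightarrow> nat \<Rightarrow> (nat \<Rightarrow> nat) \<Rightarrow> graph \<Rightarrow> state set" where
  "state_space n K \<tau> G0 =
     {(i, u, G). i \<in> {1..K} \<and> u \<in> block n \<tau> i \<and> G \<subseteq> all_pairs n \<and>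
        (\<forall>j\<in>{1..K}. \<forall>k\<in>{1..K}. j \<noteq> k \<longrightarrow>
           card (G \<inter> cross_pairs n \<tau> j k) = card (G0 \<inter> cross_pairs n \<tau> j k))}"

primrec iter_step :: "('a \<Rightarrow> 'a pmf) \<Rightarrow> nat \<Rightarrow> 'a \<Rightarrow> 'a pmf" where
  "iter_step P 0 x = return_pmf x"
| "iter_step P (Suc t) x = bind_pmf (iter_step P t x) P"

definition tv_dist :: "'a pmf \<Rightarrow> 'a pmf \<Rightarrow> real" where
  "tv_dist \<mu> \<nu> = (SUP A. \<bar>measure_pmf.prob \<mu> A - measure_pmf.prob \<nu> A\<bar>)"

definition stationary_dist :: "('a \<Rightarrow> 'a pmf) \<Rightarrow> 'a set \<Rightarrow> 'a pmf" where
  "stationary_dist P S = (THE \<pi>. set_pmf \<pi> \<subseteq> S \<and> bind_pmf \<pi> P = \<pi>)"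

text \<open>The minimum over the empty set is \<open>\<infinity>\<close>; this does not occur for an ergodic chain on
  a finite state space.\<close>

definition mixing_time :: "('a \<Rightarrow> 'a pmf) \<Rightarrow> 'a set \<Rightarrow> enat" where
  "mixing_time P S =
     Inf (enat ` {t. Max ((\<lambda>x. tv_dist (iter_step P t x) (stationary_dist P S)) ` S) < 1/4})"

definition edgelighter_mixing_time ::
    "nat \<Rightarrow> nat \<Rightarrow> (nat \<Rightarrow> nat) \<Rightarrow> (nat \<Rightarrow> real) \<Rightarrow> (nat \<Rightarrow> real) \<Rightarrow> graph \<Rightarrow> enat" where
  "edgelighter_mixing_time n K \<tau> q1 q2 G0 =
     mixing_time (walk_step n K \<tau> q1 q2) (state_space n K \<tau> G0)"

end

theory Submission
  imports Defs
begin

text \<open>A single step changes at most two pairs of the current graph. Inside the largest block, with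
  about \<open>b2 * n\<close> vertices, take one starting graph with no pair present and one with all
  pairs present. If \<open>4 * t\<close> is smaller than the number of these pairs, the laws at time
  \<open>t\<close> from the two starts have disjoint supports, so they cannot both be within \<open>1/4\<close>
  of the same distribution.\<close>

text \<open>The supremum is taken in the reals, so a single event is dominated by it only once the
  differences of probabilities are seen to be bounded, here by 1.\<close>

lemma tv_dist_ge:
  "\<bar>measure_pmf.prob \<mu> A - measure_pmf.prob \<nu> A\<bar> \<le> tv_dist \<mu> \<nu>"
proof -
  have "\<bar>measure_pmf.prob \<mu> B - measure_pmf.prob \<nu> B\<bar> \<le> 1" for B
    using measure_pmf.prob_le_1[of \<mu> B] measure_pmf.prob_le_1[of \<nu> B]
      measure_nonneg[of \<mu> B] measure_nonneg[of \<nu> B] by linarith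
  then have "bdd_above (range (\<lambda>B. \<bar>measure_pmf.prob \<mu> B - measure_pmf.prob \<nu> B\<bar>))"
    by (auto intro!: bdd_aboveI)
  then show ?thesis
    unfolding tv_dist_def by (rule cSUP_upper[OF UNIV_I])
qed

text \<open>Test both distances on the event \<open>set_pmf \<mu>\<close>: it has probability 1
  under \<open>\<mu>\<close> and 0 under \<open>\<mu>'\<close>, so if \<open>\<nu>\<close> gives it
  mass p, the distances are at least 1 - p and p.\<close>

lemma tv_dist_disjoint_supports:
  assumes "set_pmf \<mu> \<inter> set_pmf \<mu>' = {}"
  shows "1 \<le> tv_dist \<mu> \<nu> + tv_dist \<mu>' \<nu>"
proof -
  have "measure_pmf.prob \<mu> (set_pmf \<mu>) = 1"
    by (simp add: measure_pmf.prob_eq_1 AE_measure_pmf)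
  moreover have "measure_pmf.prob \<mu>' (set_pmf \<mu>) = 0"
    using assms by (simp add: measure_pmf_zero_iff Int_commute)
  ultimately show ?thesis
    using tv_dist_ge[of \<mu> "set_pmf \<mu>" \<nu>] tv_dist_ge[of \<mu>' "set_pmf \<mu>" \<nu>] by linarith
qed

text \<open>At an admissible time both laws are closer than 1/4 to one common distribution, so the
  two distances add up to less than 1/2; disjoint supports force the sum to be at least 1.\<close>

lemma mixing_time_ge_disjoint_supports:
  assumes "finite S" "x \<in> S" "y \<in> S"
    and disj: "\<And>t. t < T \<Longrightarrow> set_pmf (iter_step P t x) \<inter> set_pmf (iter_step P t y) = {}"
  shows "enat T \<le> mixing_time P S"
  unfolding mixing_time_def
proof (rule Inf_greatest, clarify)
  fix t
  let ?d = "\<lambda>z. tv_dist (iter_step P t z) (stationary_dist P S)"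
  assume "Max (?d ` S) < 1 / 4"
  then have "?d x < 1 / 4" "?d y < 1 / 4"
    using assms(1-3) by (subst (asm) Max_less_iff; auto)+
  then have "\<not> t < T"
    using tv_dist_disjoint_supports[OF disj, of t "stationary_dist P S"] by fastforce
  then show "enat T \<le> enat t" by simp
qed

text \<open>Staying toggles at most the pair \<open>{u, v}\<close>, leaving at most
  \<open>e1\<close> and \<open>e2\<close>. The case a = b is allowed, which covers a single toggled
  pair.\<close>

lemma walk_step_sym_diff:
  assumes "z \<in> set_pmf (walk_step n K \<tau> q1 q2 x)"
  shows "\<exists>a b. sym_diff (snd (snd z)) (snd (snd x)) \<subseteq> {a, b}"
proof (cases x)
  case (fields i u G)
  consider "z \<in> set_pmf (stay_step n \<tau> q1 q2 x)" | "z \<in> set_pmf (leave_step n K \<tau> x)"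
    using assms unfolding walk_step_def by (auto split: if_splits)
  then show ?thesis
  proof cases
    case 1
    then obtain v where "snd (snd z) \<in> {G, G - {{u, v}}, insert {u, v} G}"
      unfolding fields by (fastforce split: if_splits)
    then have "sym_diff (snd (snd z)) G \<subseteq> {{u, v}, {u, v}}" by auto
    then show ?thesis unfolding fields by (metis snd_conv)
  next
    case 2
    then have "snd (snd z) = G \<or> (\<exists>e1 e2. snd (snd z) = insert e2 (G - {e1}))"
      by (simp add: fields Let_def split: if_splits) (metis snd_conv)
    then obtain e1 e2 where "snd (snd z) \<in> {G, insert e2 (G - {e1})}" by auto
    then have "sym_diff (snd (snd z)) G \<subseteq> {e1, e2}" by auto
    then show ?thesis unfolding fields by (metis snd_conv)
  qed
qed

text \<open>Triangle inequality for symmetric differences, two pairs per step. Finiteness is carried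
  along because \<open>card\<close> of an infinite set is 0, which would make the bound on
  \<open>card\<close> empty.\<close>

lemma iter_walk_step_sym_diff:
  assumes "z \<in> set_pmf (iter_step (walk_step n K \<tau> q1 q2) t x)"
  shows "finite (sym_diff (snd (snd z)) (snd (snd x))) \<and>
    card (sym_diff (snd (snd z)) (snd (snd x))) \<le> 2 * t"
  using assms
proof (induction t arbitrary: z)
  case 0
  then show ?case by simp
next
  case (Suc t)
  then obtain y where y: "y \<in> set_pmf (iter_step (walk_step n K \<tau> q1 q2) t x)"
    and z: "z \<in> set_pmf (walk_step n K \<tau> q1 q2 y)" by auto
  define D where "D = sym_diff (snd (snd y)) (snd (snd x))"
  obtain a b where "sym_diff (snd (snd z)) (snd (snd y)) \<subseteq> {a, b}"
    using walk_step_sym_diff[OF z] by blast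
  then have sub: "sym_diff (snd (snd z)) (snd (snd x)) \<subseteq> D \<union> {a, b}"
    unfolding D_def by auto
  have D: "finite D" "card D \<le> 2 * t"
    using Suc.IH[OF y] unfolding D_def by auto
  have "card (D \<union> {a, b}) \<le> card D + card {a, b}" by (rule card_Un_le)
  also have "\<dots> \<le> 2 * Suc t"
    using D(2) card_insert_le_m1[of 2 "{b}" a] by simp
  finally show ?case
    using sub D(1) card_mono[OF _ sub] finite_subset[OF sub] by auto
qed

lemma iter_walk_step_disjoint_supports:
  assumes "A \<subseteq> sym_diff (snd (snd x)) (snd (snd y))" "4 * t < card A"
  shows "set_pmf (iter_step (walk_step n K \<tau> q1 q2) t x) \<inter>
    set_pmf (iter_step (walk_step n K \<tau> q1 q2) t y) = {}"
proof (rule ccontr)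
  assume "\<not> ?thesis"
  then obtain z where z: "z \<in> set_pmf (iter_step (walk_step n K \<tau> q1 q2) t x)"
      "z \<in> set_pmf (iter_step (walk_step n K \<tau> q1 q2) t y)" by auto
  let ?X = "sym_diff (snd (snd z)) (snd (snd x))"
  let ?Y = "sym_diff (snd (snd z)) (snd (snd y))"
  \<comment> \<open>A pair on which the graphs of x and y disagree is one on which the graph of z
    disagrees with one of them.\<close>
  have "A \<subseteq> ?X \<union> ?Y" using assms(1) by auto
  then have "card A \<le> card (?X \<union> ?Y)"
    using z[THEN iter_walk_step_sym_diff] by (intro card_mono) auto
  also have "\<dots> \<le> card ?X + card ?Y" by (rule card_Un_le)
  also have "\<dots> \<le> 4 * t"
    using z[THEN iter_walk_step_sym_diff] by linarith
  finally show False using assms(2) by simp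
qed

lemma finite_block [simp]: "finite (block n \<tau> k)"
  by (simp add: block_def)

lemma finite_state_space: "finite (state_space n K \<tau> G0)"
proof (rule finite_subset)
  show "state_space n K \<tau> G0 \<subseteq> {1..K} \<times> {1..n} \<times> Pow (Pow {1..n})"
    by (auto simp: state_space_def block_def all_pairs_def)
qed auto

text \<open>The two starts are \<open>G0\<close> with all pairs inside block i removed and
  \<open>G0\<close> with all of them added. Edge counts between distinct blocks stay those of
  \<open>G0\<close>, so both starts lie in the restricted state space.\<close>

lemma edgelighter_mixing_time_ge:
  assumes "G0 \<subseteq> all_pairs n" "i \<in> {1..K}" "block n \<tau> i \<noteq> {}"
    and T: "\<And>t. t < T \<Longrightarrow> 4 * t < bsize n \<tau> i choose 2"
  shows "enat T \<le> edgelighter_mixing_time n K \<tau> q1 q2 G0"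
proof -
  define A where "A = {e. e \<subseteq> block n \<tau> i \<and> card e = 2}"
  obtain u where u: "u \<in> block n \<tau> i" using assms(3) by auto
  have card_A: "card A = (bsize n \<tau> i choose 2)"
    unfolding A_def by (rule n_subsets) simp
  have cross: "A \<inter> cross_pairs n \<tau> j k = {}" if "j \<noteq> k" for j k
    using that by (auto simp: A_def cross_pairs_def block_def)
  have "A \<subseteq> all_pairs n"
    by (force simp: A_def all_pairs_def block_def card_2_iff)
  moreover have "(G0 - A) \<inter> cross_pairs n \<tau> j k = G0 \<inter> cross_pairs n \<tau> j k"
    "(G0 \<union> A) \<inter> cross_pairs n \<tau> j k = G0 \<inter> cross_pairs n \<tau> j k" if "j \<noteq> k" for j k
    using cross[OF that] by auto
  ultimately have S: "(i, u, G0 - A) \<in> state_space n K \<tau> G0" "(i, u, G0 \<union> A) \<in> state_space n K \<tau> G0"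
    using assms(1,2) u by (auto simp: state_space_def)
  show ?thesis
    unfolding edgelighter_mixing_time_def
    by (intro mixing_time_ge_disjoint_supports[OF finite_state_space S]
        iter_walk_step_disjoint_supports[of A]) (auto simp: card_A T)
qed

text \<open>An almost sure statement about a pmf is one about every graph in its support; this
  inclusion makes the bound for a fixed \<open>G0\<close> applicable to each of them.\<close>

lemma set_pmf_SBM_subset: "G \<in> set_pmf (SBM n \<Lambda> \<tau>) \<Longrightarrow> G \<subseteq> all_pairs n"
  by (auto simp: SBM_def)

theorem lemma2:
  fixes a1 a2 b1 b2 b3 q :: real
    and K :: nat
    and I :: "nat set"
    and \<tau> :: "nat \<Rightarrow> nat \<Rightarrow> nat"
    and \<Lambda> :: "nat \<Rightarrow> nat \<Rightarrow> nat \<Rightarrow> real"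
  assumes "0 < a1" "a1 < a2" "a2 < 1" "0 < b1" "0 < b2" "0 < b3"
    and "2 \<le> K"
    and "0 < q" "q < 1"
    and "infinite I"
    and "\<And>n. n \<in> I \<Longrightarrow> \<tau> n \<in> {1..n} \<rightarrow> {1..K}"
    and "\<And>n i j. n \<in> I \<Longrightarrow> i \<in> {1..K} \<Longrightarrow> j \<in> {1..K} \<Longrightarrow>
           0 \<le> \<Lambda> n i j \<and> \<Lambda> n i j \<le> 1 \<and> \<Lambda> n i j = \<Lambda> n j i"
    and "\<And>n i. n \<in> I \<Longrightarrow> i \<in> {1..K} \<Longrightarrow> bsize n (\<tau> n) 1 \<le> bsize n (\<tau> n) i"
    and "(\<lambda>n. real (bsize n (\<tau> n) 1))
           \<sim>[inf sequentially (principal I)] (\<lambda>n. b1 * real n powr a1)"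
    and "(\<lambda>n. real (MAX i\<in>{1..K}. bsize n (\<tau> n) i))
           \<sim>[inf sequentially (principal I)] (\<lambda>n. b2 * real n)"
    and "\<And>n j. n \<in> I \<Longrightarrow> j \<in> {1..K} \<Longrightarrow> j \<noteq> 1 \<Longrightarrow>
           \<Lambda> n 1 j \<le> b3 * (real n powr a2 / (real (bsize n (\<tau> n) j) * real (bsize n (\<tau> n) 1)))"
    and "\<And>n i j. n \<in> I \<Longrightarrow> i \<in> {1..K} \<Longrightarrow> j \<in> {1..K} \<Longrightarrow> i \<noteq> j \<Longrightarrow>
           \<Lambda> n i j \<ge> 5 * (ln (real n) / (real (bsize n (\<tau> n) i) * real (bsize n (\<tau> n) j)))"
    and "\<And>n i. n \<in> I \<Longrightarrow> i \<in> {1..K} \<Longrightarrow>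
           \<Lambda> n i i \<ge> 5 * (ln (real n) / real (bsize n (\<tau> n) i choose 2))"
  shows "\<exists>C>0. \<exists>n0. \<forall>n\<in>I. n \<ge> n0 \<longrightarrow>
           (AE G0 in measure_pmf (SBM n (\<Lambda> n) (\<tau> n)).
              ereal (C * (real n)\<^sup>2)
                \<le> ereal_of_enat (edgelighter_mixing_time n K (\<tau> n) (\<lambda>_. 1 - q) (\<lambda>_. q) G0))"
proof -
  let ?m = "\<lambda>n. MAX i\<in>{1..K}. bsize n (\<tau> n) i"
  \<comment> \<open>Asymptotic equivalence along \<open>I\<close> gives a lower bound with any
    factor below 1; 1/2 is chosen.\<close>
  have "\<forall>\<^sub>F n in inf sequentially (principal I). 1 / 2 * (b2 * real n) \<le> real (?m n)"
  proof -
    have "\<forall>\<^sub>F n in inf sequentially (principal I). norm (real (?m n)) \<ge> 1 / 2 * norm (b2 * real n)"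
      using asymp_equiv_imp_eventually_ge[OF assms(15), of "1/2"] by simp
    then show ?thesis using assms(5) by (simp add: abs_mult)
  qed
  then obtain N where N: "\<And>n. n \<ge> N \<Longrightarrow> n \<in> I \<Longrightarrow> b2 * real n / 2 \<le> real (?m n)"
    by (auto simp: eventually_inf_principal eventually_sequentially)
  \<comment> \<open>With m \<ge> b2 * n / 2, the block has at least m^2 / 4 \<ge> b2^2 * n^2 / 16
    pairs; the condition on \<open>4 * t\<close> costs another factor 4.\<close>
  define C where "C = b2\<^sup>2 / 64"
  \<comment> \<open>The second entry ensures b2 * n \<ge> 4, hence m \<ge> 2, from which on m * (m -
    1) / 2 \<ge> m^2 / 4.\<close>
  define n0 where "n0 = max N (nat \<lceil>4 / b2\<rceil>)"
  have "C > 0" using assms(5) by (simp add: C_def)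
  moreover have "ereal (C * (real n)\<^sup>2)
      \<le> ereal_of_enat (edgelighter_mixing_time n K (\<tau> n) (\<lambda>_. 1 - q) (\<lambda>_. q) G0)"
    if n: "n \<in> I" "n \<ge> n0" and G0: "G0 \<in> set_pmf (SBM n (\<Lambda> n) (\<tau> n))" for n G0
  proof -
    have "?m n \<in> (\<lambda>i. bsize n (\<tau> n) i) ` {1..K}"
      using assms(7) by (intro Max_in) auto
    then obtain i where i: "i \<in> {1..K}" "bsize n (\<tau> n) i = ?m n" by auto
    define m where "m = bsize n (\<tau> n) i"
    have m: "b2 * real n / 2 \<le> real m" using N n i by (simp add: m_def n0_def)
    have "4 / b2 \<le> real n" using n(2) by (simp add: n0_def)
    then have bn: "4 \<le> b2 * real n" using assms(5) by (simp add: field_simps)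
    then have "2 \<le> m" using m by linarith
    \<comment> \<open>Rounding up makes t < T equivalent to t < C * n^2 for natural t, while T
      itself is still at least C * n^2.\<close>
    define T where "T = nat \<lceil>C * (real n)\<^sup>2\<rceil>"
    have bound: "4 * (C * (real n)\<^sup>2) \<le> real (m choose 2)"
    proof -
      have "(b2 * real n / 2)\<^sup>2 \<le> (real m)\<^sup>2" using m bn by (intro power_mono) auto
      then have "4 * (C * (real n)\<^sup>2) \<le> (real m)\<^sup>2 / 4"
        by (simp add: C_def power_mult_distrib power_divide)
      also have "\<dots> \<le> real m * (real m - 1) / 2"
      proof -
        have "2 * real m \<le> real m * real m" using \<open>2 \<le> m\<close> by (intro mult_right_mono) auto
        then show ?thesis by (simp add: power2_eq_square right_diff_distrib)
      qed
      also have "\<dots> = real (m choose 2)"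
        using \<open>2 \<le> m\<close> by (simp add: choose_two real_of_nat_div of_nat_diff)
      finally show ?thesis .
    qed
    have "4 * t < m choose 2" if "t < T" for t
    proof -
      have "real t < C * (real n)\<^sup>2" using that by (simp add: T_def zless_nat_eq_int_zless less_ceiling_iff)
      then show ?thesis using bound by linarith
    qed
    moreover have "block n (\<tau> n) i \<noteq> {}" using \<open>2 \<le> m\<close> by (auto simp: m_def)
    ultimately have "enat T \<le> edgelighter_mixing_time n K (\<tau> n) (\<lambda>_. 1 - q) (\<lambda>_. q) G0"
      using set_pmf_SBM_subset[OF G0] i(1) by (intro edgelighter_mixing_time_ge) (auto simp: m_def)
    then have "ereal_of_enat (enat T)
        \<le> ereal_of_enat (edgelighter_mixing_time n K (\<tau> n) (\<lambda>_. 1 - q) (\<lambda>_. q) G0)"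
      by (simp only: ereal_of_enat_le_iff)
    moreover have "ereal (C * (real n)\<^sup>2) \<le> ereal_of_enat (enat T)"
      by (simp add: T_def real_nat_ceiling_ge)
    ultimately show ?thesis by (rule order_trans[rotated])
  qed
  ultimately show ?thesis
    by (intro exI[of _ C] conjI exI[of _ n0]) (auto simp: AE_measure_pmf_iff)
qed

end
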